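(* Let $(\Omega,T)$ be a dynamical system and let $I\subset\mathbb{R}$ be an interval. Then the set $$U(I,\Omega)=\{A\in C(I\times\Omega,\mathrm{SL}(2,\mathbb{R})) : A(E,\cdot)\text{ is uniform for each }E\in I\}$$ is a $G_\delta$-set in $C(I\times\Omega,\mathrm{SL}(2,\mathbb{R}))$.
   Context: A dynamical system is a pair $(\Omega,T)$ with $\Omega$ a compact metric space and $T:\Omega\to\Omega$ a homeomorphism. $\mathrm{SL}(2,\mathbb{R})$ is the set of real $2\times2$ matrices of determinant one, and $\|\cdot\|$ is the operator norm. $C(I\times\Omega,\mathrm{SL}(2,\mathbb{R}))$ is the set of continuous maps $I\times\Omega\to\mathrm{SL}(2,\mathbb{R})$, equipped with the topology of local uniform convergence. A continuous map $A:\Omega\to\mathrm{SL}(2,\mathbb{R})$ is called a (continuous) cocycle; for $n\in\mathbb{N}=\{1,2,\dots\}$ put $A_n(\omega)=A(T^{n-1}\omega)\cdots A(T\omega)A(\omega)$. A cocycle $A$ is uniform if there is a number $L(A)$ such that $\lim_{n\to\infty}\frac1n\log\|A_n(\omega)\|=L(A)$ uniformly in $\omega\in\Omega$. *)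

theory Defs
  imports "HOL-Analysis.Analysis"
begin

definition dynamical_system :: "'a::metric_space set \<Rightarrow> ('a \<Rightarrow> 'a) \<Rightarrow> bool"
  where "dynamical_system \<Omega> T \<longleftrightarrow> compact \<Omega> \<and> (\<exists>S. homeomorphism \<Omega> \<Omega> T S)"

definition SL2R :: "(real^2^2) set"
  where "SL2R = {M. det M = 1}"

definition op_norm :: "real^2^2 \<Rightarrow> real"
  where "op_norm M = onorm (\<lambda>v. M *v v)"

text \<open>The members are extensional (\<open>undefined\<close> outside \<open>X\<close>), so that equality of members is
  equality of maps on \<open>X\<close>.\<close>

definition cont_maps :: "'a::topological_space set \<Rightarrow> 'b::topological_space set \<Rightarrow> ('a \<Rightarrow> 'b) set"
  where "cont_maps X Y = {f \<in> X \<rightarrow>\<^sub>E Y. continuous_on X f}"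

text \<open>The topology of local uniform convergence on \<open>C(X,Y)\<close>, given by uniform closeness on
  compact subsets of \<open>X\<close>. For locally compact \<open>X\<close>, such as an interval times a compact space,
  convergence in it is uniform convergence on a neighbourhood of each point; see
  \<open>limitin_loc_unif_topology\<close> below.\<close>

definition loc_unif_topology ::
    "'a::topological_space set \<Rightarrow> 'b::metric_space set \<Rightarrow> ('a \<Rightarrow> 'b) topology"
  where "loc_unif_topology X Y = topology (\<lambda>W. W \<subseteq> cont_maps X Y \<and>
     (\<forall>f\<in>W. \<exists>K e. compact K \<and> K \<subseteq> X \<and> e > 0 \<and>
        {g \<in> cont_maps X Y. \<forall>x\<in>K. dist (g x) (f x) < e} \<subseteq> W))"

lemma openin_loc_unif_topology:
  "openin (loc_unif_topology X Y) W \<longleftrightarrow> W \<subseteq> cont_maps X Y \<and>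
     (\<forall>f\<in>W. \<exists>K e. compact K \<and> K \<subseteq> X \<and> e > 0 \<and>
        {g \<in> cont_maps X Y. \<forall>x\<in>K. dist (g x) (f x) < e} \<subseteq> W)"
proof -
  let ?B = "\<lambda>f K e. {g \<in> cont_maps X Y. \<forall>x\<in>K. dist (g x) (f x) < e}"
  let ?P = "\<lambda>W. W \<subseteq> cont_maps X Y \<and>
     (\<forall>f\<in>W. \<exists>K e. compact K \<and> K \<subseteq> X \<and> e > 0 \<and> ?B f K e \<subseteq> W)"
  have "istopology ?P"
    unfolding istopology_def
  proof (intro conjI allI impI)
    fix S T assume S: "?P S" and T: "?P T"
    show "S \<inter> T \<subseteq> cont_maps X Y" using S by blast
    show "\<forall>f\<in>S \<inter> T. \<exists>K e. compact K \<and> K \<subseteq> X \<and> e > 0 \<and> ?B f K e \<subseteq> S \<inter> T"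
    proof
      fix f assume f: "f \<in> S \<inter> T"
      obtain K d where K: "compact K" "K \<subseteq> X" "d > 0" "?B f K d \<subseteq> S"
        using S f by blast
      obtain L e where L: "compact L" "L \<subseteq> X" "e > 0" "?B f L e \<subseteq> T"
        using T f by blast
      have "?B f (K \<union> L) (min d e) \<subseteq> ?B f K d \<inter> ?B f L e" by auto
      with K L have "compact (K \<union> L) \<and> K \<union> L \<subseteq> X \<and> min d e > 0 \<and>
          ?B f (K \<union> L) (min d e) \<subseteq> S \<inter> T"
        by (intro conjI compact_Un) auto
      then show "\<exists>K e. compact K \<and> K \<subseteq> X \<and> e > 0 \<and> ?B f K e \<subseteq> S \<inter> T" by blast
    qed
  next
    fix \<K> assume "\<forall>S\<in>\<K>. ?P S"
    then have h: "\<And>S. S \<in> \<K> \<Longrightarrow> ?P S" by blast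
    show "\<Union>\<K> \<subseteq> cont_maps X Y" using h by blast
    show "\<forall>f\<in>\<Union>\<K>. \<exists>K e. compact K \<and> K \<subseteq> X \<and> e > 0 \<and> ?B f K e \<subseteq> \<Union>\<K>"
    proof
      fix f assume "f \<in> \<Union>\<K>"
      then obtain S where S: "S \<in> \<K>" "f \<in> S" by blast
      then obtain K d where K: "compact K" "K \<subseteq> X" "d > 0" "?B f K d \<subseteq> S"
        using h[OF S(1)] by blast
      then show "\<exists>K e. compact K \<and> K \<subseteq> X \<and> e > 0 \<and> ?B f K e \<subseteq> \<Union>\<K>"
        using S by (meson Union_upper order_trans)
    qed
  qed
  then show ?thesis
    unfolding loc_unif_topology_def by (simp add: topology_inverse')
qed

lemma topspace_loc_unif_topology: "topspace (loc_unif_topology X Y) = cont_maps X Y"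
proof -
  have "openin (loc_unif_topology X Y) (cont_maps X Y)"
    unfolding openin_loc_unif_topology
    by (auto intro!: exI[of _ "{}"] exI[of _ "1::real"])
  then show ?thesis
    by (meson openin_loc_unif_topology openin_subset openin_topspace subset_antisym)
qed

lemma openin_loc_unif_ball:
  assumes f: "f \<in> cont_maps X Y" and K: "compact K" "K \<subseteq> X"
  shows "openin (loc_unif_topology X Y) {g \<in> cont_maps X Y. \<forall>x\<in>K. dist (g x) (f x) < e}"
  unfolding openin_loc_unif_topology
proof (intro conjI ballI)
  fix g assume g: "g \<in> {g \<in> cont_maps X Y. \<forall>x\<in>K. dist (g x) (f x) < e}"
  have "\<exists>d>0. \<forall>x\<in>K. dist (g x) (f x) + d \<le> e"
  proof (cases "K = {}")
    case True then show ?thesis by (auto intro: exI[of _ 1])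
  next
    case False
    have "continuous_on K (\<lambda>x. dist (g x) (f x))"
      using f g K by (auto simp: cont_maps_def intro!: continuous_on_dist intro: continuous_on_subset)
    from continuous_attains_sup[OF K(1) False this] obtain z
      where "z \<in> K" "\<forall>x\<in>K. dist (g x) (f x) \<le> dist (g z) (f z)" by blast
    with g show ?thesis by (auto intro!: exI[of _ "e - dist (g z) (f z)"])
  qed
  then obtain d where d: "d > 0" "\<And>x. x \<in> K \<Longrightarrow> dist (g x) (f x) + d \<le> e" by blast
  have "dist (h x) (f x) < e" if "x \<in> K" "dist (h x) (g x) < d" for h x
    using d(2)[OF that(1)] that(2) dist_triangle[of "h x" "f x" "g x"] by linarith
  with d(1) K show "\<exists>L d. compact L \<and> L \<subseteq> X \<and> d > 0 \<and>
      {h \<in> cont_maps X Y. \<forall>x\<in>L. dist (h x) (g x) < d}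
        \<subseteq> {g \<in> cont_maps X Y. \<forall>x\<in>K. dist (g x) (f x) < e}"
    by (intro exI[of _ K] exI[of _ d]) auto
qed auto

lemma limitin_loc_unif_topology_compact:
  "limitin (loc_unif_topology X Y) f g F \<longleftrightarrow> g \<in> cont_maps X Y \<and>
     (\<forall>\<^sub>F i in F. f i \<in> cont_maps X Y) \<and>
     (\<forall>K. compact K \<and> K \<subseteq> X \<longrightarrow> uniform_limit K f g F)" (is "?l \<longleftrightarrow> ?r")
proof
  assume l: ?l
  then have g: "g \<in> cont_maps X Y"
    by (simp add: limitin_def topspace_loc_unif_topology)
  have ev: "\<forall>\<^sub>F i in F. f i \<in> {h \<in> cont_maps X Y. \<forall>x\<in>K. dist (h x) (g x) < e}"
    if "compact K" "K \<subseteq> X" "e > 0" for K e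
    using l openin_loc_unif_ball[OF g that(1,2), of e] that(3) g unfolding limitin_def by auto
  show ?r
  proof (intro conjI allI impI)
    show "\<forall>\<^sub>F i in F. f i \<in> cont_maps X Y"
      using ev[of "{}" 1] by (auto elim: eventually_mono)
    fix K assume "compact K \<and> K \<subseteq> X"
    then show "uniform_limit K f g F"
      unfolding uniform_limit_iff
      by (intro allI impI, elim conjE) (rule eventually_mono[OF ev], auto)
  qed (rule g)
next
  assume r: ?r
  show ?l
    unfolding limitin_def topspace_loc_unif_topology
  proof (intro conjI allI impI)
    fix W assume W: "openin (loc_unif_topology X Y) W \<and> g \<in> W"
    then obtain K e where K: "compact K" "K \<subseteq> X" "e > 0"
        "{h \<in> cont_maps X Y. \<forall>x\<in>K. dist (h x) (g x) < e} \<subseteq> W"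
      unfolding openin_loc_unif_topology by blast
    have "\<forall>\<^sub>F i in F. \<forall>x\<in>K. dist (f i x) (g x) < e"
      using r K unfolding uniform_limit_iff by blast
    moreover have "\<forall>\<^sub>F i in F. f i \<in> cont_maps X Y" using r by blast
    ultimately show "\<forall>\<^sub>F i in F. f i \<in> W"
      by eventually_elim (use K(4) in auto)
  qed (use r in blast)
qed

lemma limitin_loc_unif_topology:
  assumes "locally compact X"
  shows "limitin (loc_unif_topology X Y) f g F \<longleftrightarrow> g \<in> cont_maps X Y \<and>
     (\<forall>\<^sub>F i in F. f i \<in> cont_maps X Y) \<and>
     (\<forall>x\<in>X. \<exists>U. openin (top_of_set X) U \<and> x \<in> U \<and> uniform_limit U f g F)"
proof -
  have "(\<forall>K. compact K \<and> K \<subseteq> X \<longrightarrow> uniform_limit K f g F) \<longleftrightarrow>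
     (\<forall>x\<in>X. \<exists>U. openin (top_of_set X) U \<and> x \<in> U \<and> uniform_limit U f g F)" (is "?l \<longleftrightarrow> ?r")
  proof
    assume l: ?l
    show ?r
    proof
      fix x assume "x \<in> X"
      then obtain U K where "openin (top_of_set X) U" "compact K" "x \<in> U" "U \<subseteq> K" "K \<subseteq> X"
        using assms unfolding locally_def by (metis openin_subtopology_self)
      with l show "\<exists>U. openin (top_of_set X) U \<and> x \<in> U \<and> uniform_limit U f g F"
        by (meson uniform_limit_on_subset)
    qed
  next
    assume r: ?r
    show ?l
    proof (intro allI impI)
      fix K assume K: "compact K \<and> K \<subseteq> X"
      have "\<exists>V. open V \<and> x \<in> V \<and> uniform_limit (X \<inter> V) f g F" if "x \<in> X" for x
        using r that unfolding openin_open by (metis IntE)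
      then obtain V where V: "\<And>x. x \<in> X \<Longrightarrow> open (V x) \<and> x \<in> V x \<and> uniform_limit (X \<inter> V x) f g F"
        by metis
      obtain D where D: "D \<subseteq> K" "finite D" "K \<subseteq> (\<Union>x\<in>D. V x)"
        using K V by (elim conjE compactE_image[of K K V]) blast+
      have "uniform_limit (\<Union>x\<in>D. X \<inter> V x) f g F"
        using D K V by (intro uniform_limit_on_UNION) auto
      then show "uniform_limit K f g F"
        by (rule uniform_limit_on_subset) (use D K in blast)
    qed
  qed
  then show ?thesis unfolding limitin_loc_unif_topology_compact by simp
qed

primrec cocycle_iterate :: "('a \<Rightarrow> 'a) \<Rightarrow> ('a \<Rightarrow> real^2^2) \<Rightarrow> nat \<Rightarrow> 'a \<Rightarrow> real^2^2"
  where
    "cocycle_iterate T A 0 \<omega> = mat 1"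
  | "cocycle_iterate T A (Suc n) \<omega> = A ((T ^^ n) \<omega>) ** cocycle_iterate T A n \<omega>"

definition uniform_cocycle :: "'a set \<Rightarrow> ('a \<Rightarrow> 'a) \<Rightarrow> ('a \<Rightarrow> real^2^2) \<Rightarrow> bool"
  where "uniform_cocycle \<Omega> T A \<longleftrightarrow>
    (\<exists>L. uniform_limit \<Omega> (\<lambda>n \<omega>. 1 / real n * ln (op_norm (cocycle_iterate T A n \<omega>)))
            (\<lambda>_. L) sequentially)"

definition U_set :: "real set \<Rightarrow> 'a::metric_space set \<Rightarrow> ('a \<Rightarrow> 'a) \<Rightarrow> (real \<times> 'a \<Rightarrow> real^2^2) set"
  where "U_set I \<Omega> T =
    {A \<in> cont_maps (I \<times> \<Omega>) SL2R. \<forall>E\<in>I. uniform_cocycle \<Omega> T (\<lambda>\<omega>. A (E, \<omega>))}"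

end

theory Submission
  imports Defs
begin

text \<open>
  Uniformity asks for convergence of the averages \<open>ln (op_norm A\<^sub>n) / n\<close> along all large \<open>n\<close>, which is
  not visibly a countable combination of open conditions. The point of the proof is that two scales
  suffice: \<open>A\<close> is uniform iff for every \<open>\<epsilon> > 0\<close> there is one \<open>n \<ge> 1/\<epsilon>\<close> such that the averages at the
  times \<open>n\<close> and \<open>2n\<close> all lie within less than \<open>\<epsilon>\<close> of one number \<open>a\<close>
  (\<open>uniform_cocycle_iff_nearly_uniform\<close>).

  Only the converse needs an argument. Subadditivity turns the bound at time \<open>n\<close> into the upper bound
  \<open>a + O(\<epsilon>)\<close> for the averages at all large times. The lower bound is the harder one, as a product of
  large matrices may be small. If \<open>a\<close> is of order \<open>\<epsilon>\<close>, it holds because norms in \<open>SL(2,\<real>)\<close> are at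
  least one. Otherwise, cut a long product into blocks of length \<open>n\<close>. Each block has norm at least
  \<open>exp (n (a - \<epsilon>))\<close>, and comparing the times \<open>n\<close> and \<open>2n\<close> shows that multiplying two consecutive
  blocks loses at most a factor \<open>exp (4n\<epsilon>)\<close>, much less than the norm of a block. In this situation the
  norm of the whole product is comparable, block by block, with the product of the norms: this is a
  one-sided form of the avalanche principle (\<open>op_norm_product_lower_bound\<close>), which follows by
  induction from the inequality \<open>op_norm_mult_mult_le\<close> for three matrices.

  For fixed \<open>\<epsilon>\<close> the two-scale condition involves finitely many iterates, so it is open under uniform
  convergence (\<open>eventually_nearly_uniform\<close>). By compactness, asking it for all \<open>E\<close> in a compact
  set of parameters is open for local uniform convergence (\<open>openin_loc_unif_all_slices\<close>). An interval is
  a countable union of compact intervals, and \<open>\<epsilon>\<close> may run through \<open>1/(k+1)\<close>, so the set in question is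
  a countable intersection of open sets.
\<close>

section \<open>The operator norm of two-by-two matrices\<close>

lemma norm_matrix_vector_le_op_norm: "norm (M *v x) \<le> op_norm M * norm x"
  unfolding op_norm_def by (rule onorm) simp

lemma op_norm_leI: "(\<And>x. norm (M *v x) \<le> b * norm x) \<Longrightarrow> op_norm M \<le> b"
  unfolding op_norm_def by (rule onorm_le)

lemma op_norm_nonneg: "0 \<le> op_norm M"
  unfolding op_norm_def by (rule onorm_pos_le) simp

lemma op_norm_mult_le: "op_norm (M ** N) \<le> op_norm M * op_norm N"
proof (rule op_norm_leI)
  fix x
  have "norm ((M ** N) *v x) \<le> op_norm M * norm (N *v x)"
    using norm_matrix_vector_le_op_norm[of M "N *v x"] by (simp add: matrix_vector_mul_assoc)
  also have "\<dots> \<le> op_norm M * (op_norm N * norm x)"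
    by (intro mult_left_mono norm_matrix_vector_le_op_norm op_norm_nonneg)
  finally show "norm ((M ** N) *v x) \<le> op_norm M * op_norm N * norm x" by (simp add: mult.assoc)
qed

lemma op_norm_add_le: "op_norm (M + N) \<le> op_norm M + op_norm N"
  unfolding op_norm_def
  using onorm_triangle[of "(*v) M" "(*v) N"]
  by (simp add: matrix_vector_mult_add_rdistrib[abs_def])

lemma op_norm_mat_1: "op_norm (mat 1) = 1"
  using onorm_id[where 'a = "real^2"] by (simp add: op_norm_def)

lemma op_norm_le_norm: "op_norm M \<le> norm M"
proof (rule op_norm_leI)
  fix x
  have "norm (M *v x) = L2_set (\<lambda>i. norm ((M *v x) $ i)) UNIV" by (simp add: norm_vec_def)
  also have "\<dots> \<le> L2_set (\<lambda>i. norm (M $ i) * norm x) UNIV"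
    by (intro L2_set_mono) (auto simp: matrix_vector_mul_component Cauchy_Schwarz_ineq2)
  also have "\<dots> = norm M * norm x"
    by (simp add: norm_vec_def L2_set_right_distrib mult.commute L2_set_left_distrib)
  finally show "norm (M *v x) \<le> norm M * norm x" .
qed

lemma abs_op_norm_diff_le: "\<bar>op_norm M - op_norm N\<bar> \<le> norm (M - N)"
  using op_norm_add_le[of "M - N" N] op_norm_le_norm[of "M - N"]
    op_norm_add_le[of "N - M" M] op_norm_le_norm[of "N - M"]
  by (simp add: norm_minus_commute)

definition cross2 :: "real^2 \<Rightarrow> real^2 \<Rightarrow> real"
  where "cross2 x y = x $ 1 * y $ 2 - x $ 2 * y $ 1"

text \<open>Lagrange's identity: the squares of the signed area and of the inner product add up to the
  square of the product of the norms.\<close>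

lemma abs_cross2_le: "\<bar>cross2 x y\<bar> \<le> norm x * norm y"
proof (rule power2_le_imp_le)
  have "\<bar>cross2 x y\<bar>\<^sup>2 + (x \<bullet> y)\<^sup>2 = (norm x * norm y)\<^sup>2"
    by (simp add: cross2_def power_mult_distrib power2_norm_eq_inner inner_vec_def sum_2)
       (simp add: power2_eq_square algebra_simps)
  then show "\<bar>cross2 x y\<bar>\<^sup>2 \<le> (norm x * norm y)\<^sup>2" by (smt (verit) zero_le_power2)
qed simp

lemma cross2_mult: "cross2 (M *v x) (M *v y) = det M * cross2 x y"
  by (simp add: cross2_def det_2 matrix_vector_mult_def sum_2 algebra_simps)

text \<open>A matrix of determinant one preserves the area of the unit square, while it enlarges that area at
  most by the square of its norm.\<close>

lemma op_norm_ge_1: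
  assumes "det M = 1" shows "1 \<le> op_norm M"
proof -
  let ?x = "axis 1 1 :: real^2" and ?y = "axis 2 1 :: real^2"
  have "1 = \<bar>cross2 (M *v ?x) (M *v ?y)\<bar>"
    by (simp add: cross2_mult assms) (simp add: cross2_def axis_def)
  also have "\<dots> \<le> norm (M *v ?x) * norm (M *v ?y)" by (rule abs_cross2_le)
  also have "\<dots> \<le> op_norm M * op_norm M"
    using norm_matrix_vector_le_op_norm[of M ?x] norm_matrix_vector_le_op_norm[of M ?y]
    by (intro mult_mono) (auto simp: op_norm_nonneg)
  finally show ?thesis
    using op_norm_nonneg[of M] by (metis mult_less_cancel_left2 mult_strict_mono not_less order_le_less_trans zero_less_one mult_1)
qed

text \<open>This is the multiplicativity of two-by-two determinants: the left side is the determinant of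
  the matrix of values of the bilinear form of \<open>B\<close> on the pairs \<open>x, z\<close> and \<open>y, w\<close>. Up to the term with
  \<open>det B\<close> the form behaves as if it had rank one, so that arguments may be exchanged between two
  factors.\<close>

lemma cross2_interchange:
  "(x \<bullet> (B *v y)) * (z \<bullet> (B *v w)) - (x \<bullet> (B *v w)) * (z \<bullet> (B *v y))
    = det B * (cross2 x z * cross2 y w)"
  by (simp add: cross2_def det_2 matrix_vector_mult_def sum_2 inner_vec_def algebra_simps)

lemma norm_transpose_mult_le: "norm (transpose M *v x) \<le> op_norm M * norm x"
proof -
  let ?y = "transpose M *v x"
  have "norm ?y * norm ?y = x \<bullet> (M *v ?y)"
    by (metis dot_lmul_matrix power2_norm_eq_inner power2_eq_square vector_transpose_matrix inner_commute transpose_matrix_vector)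
  also have "\<dots> \<le> norm x * (op_norm M * norm ?y)"
    using norm_cauchy_schwarz[of x "M *v ?y"] norm_matrix_vector_le_op_norm[of M ?y]
    by (meson mult_left_mono norm_ge_zero order_trans)
  finally show ?thesis
    by (cases "?y = 0") (auto simp: op_norm_nonneg mult.left_commute[of _ "op_norm M"] mult.commute[of _ "op_norm M"] mult.assoc[symmetric]
      simp del: transpose_matrix_vector)
qed

text \<open>Insertion of a third factor: if \<open>B\<close> is nearly of rank one, in the sense that its determinant is
  small compared with the square of its norm, then \<open>C ** B ** D\<close> cannot be small unless \<open>C ** B\<close> or
  \<open>B ** D\<close> already is. The proof tests \<open>cross2_interchange\<close> on vectors for which the two factors on the left
  become the squares of \<open>norm ((C ** B) *v q)\<close> and \<open>norm ((B ** D) *v s)\<close>, and then passes to the supremum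
  over \<open>q\<close> and \<open>s\<close>.\<close>

lemma op_norm_mult_mult_le:
  "op_norm (C ** B) * op_norm (B ** D)
    \<le> op_norm B * op_norm (C ** B ** D) + \<bar>det B\<bar> * op_norm C * op_norm D" (is "_ \<le> ?R")
proof -
  have R: "0 \<le> ?R" by (simp add: op_norm_nonneg)
  have vec: "norm ((C ** B) *v q) * norm ((B ** D) *v s) \<le> ?R * norm q * norm s" for q s
  proof -
    define p r where "p = (C ** B) *v q" and "r = (B ** D) *v s"
    define x where "x = transpose C *v p"
    have x: "x \<bullet> u = p \<bullet> (C *v u)" for u
      unfolding x_def by (metis dot_lmul_matrix transpose_matrix_vector)
    have "(norm p * norm r) * (norm p * norm r) = (x \<bullet> (B *v q)) * (r \<bullet> (B *v (D *v s)))"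
      by (simp add: x) (simp add: p_def r_def matrix_vector_mul_assoc dot_square_norm power2_eq_square mult_ac)
    also have "\<dots> = (x \<bullet> (B *v (D *v s))) * (r \<bullet> (B *v q))
        + det B * (cross2 x r * cross2 q (D *v s))"
      using cross2_interchange[of x B q r "D *v s"] by linarith
    also have "\<dots> \<le> (norm p * (op_norm (C ** B ** D) * norm s)) * (norm r * (op_norm B * norm q))
        + \<bar>det B\<bar> * ((op_norm C * norm p * norm r) * (norm q * (op_norm D * norm s)))"
    proof (rule add_mono)
      have 1: "\<bar>x \<bullet> (B *v (D *v s))\<bar> \<le> norm p * (op_norm (C ** B ** D) * norm s)"
        using Cauchy_Schwarz_ineq2[of p "(C ** B ** D) *v s"]
          norm_matrix_vector_le_op_norm[of "C ** B ** D" s]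
        unfolding x by (simp add: matrix_vector_mul_assoc[symmetric])
          (meson mult_left_mono norm_ge_zero order_trans)
      have 2: "\<bar>r \<bullet> (B *v q)\<bar> \<le> norm r * (op_norm B * norm q)"
        using Cauchy_Schwarz_ineq2[of r "B *v q"] norm_matrix_vector_le_op_norm[of B q]
        by (meson mult_left_mono norm_ge_zero order_trans)
      show "(x \<bullet> (B *v (D *v s))) * (r \<bullet> (B *v q))
          \<le> (norm p * (op_norm (C ** B ** D) * norm s)) * (norm r * (op_norm B * norm q))"
        using mult_mono[OF 1 2 order_trans[OF abs_ge_zero 1] abs_ge_zero]
        unfolding abs_mult[symmetric] by linarith
      have 3: "\<bar>cross2 x r\<bar> \<le> op_norm C * norm p * norm r"
        using abs_cross2_le[of x r] norm_transpose_mult_le[of C p]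
        unfolding x_def[symmetric] by (meson mult_right_mono norm_ge_zero order_trans)
      have 4: "\<bar>cross2 q (D *v s)\<bar> \<le> norm q * (op_norm D * norm s)"
        using abs_cross2_le[of q "D *v s"] norm_matrix_vector_le_op_norm[of D s]
        by (meson mult_left_mono norm_ge_zero order_trans)
      have "\<bar>det B * (cross2 x r * cross2 q (D *v s))\<bar>
          \<le> \<bar>det B\<bar> * ((op_norm C * norm p * norm r) * (norm q * (op_norm D * norm s)))"
        unfolding abs_mult
        by (intro mult_left_mono mult_mono 3 4) (auto simp: op_norm_nonneg)
      then show "det B * (cross2 x r * cross2 q (D *v s))
          \<le> \<bar>det B\<bar> * ((op_norm C * norm p * norm r) * (norm q * (op_norm D * norm s)))"
        by linarith
    qed
    also have "\<dots> = (norm p * norm r) * (?R * norm q * norm s)"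
      by (simp add: algebra_simps)
    finally have "(norm p * norm r) * (norm p * norm r) \<le> (norm p * norm r) * (?R * norm q * norm s)" .
    moreover have "0 \<le> ?R * norm q * norm s" using R by simp
    moreover have "0 \<le> norm p * norm r" by simp
    ultimately have "norm p * norm r \<le> ?R * norm q * norm s"
      by (metis mult_le_cancel_left order_le_less)
    then show ?thesis by (simp only: p_def r_def)
  qed
  \<comment> \<open>Supremum over \<open>q\<close> first, with \<open>s\<close> fixed, then over \<open>s\<close>.\<close>
  have left: "op_norm (C ** B) * norm ((B ** D) *v s) \<le> ?R * norm s" for s
  proof (cases "(B ** D) *v s = 0")
    case False
    then have pos: "0 < norm ((B ** D) *v s)" by simp
    have "op_norm (C ** B) \<le> ?R * norm s / norm ((B ** D) *v s)"
      by (rule op_norm_leI) (use vec[of _ s] pos in \<open>simp add: field_simps\<close>)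
    then show ?thesis using pos by (simp add: field_simps)
  qed (use R in simp)
  show ?thesis
  proof (cases "op_norm (C ** B) = 0")
    case False
    then have pos: "0 < op_norm (C ** B)" using op_norm_nonneg[of "C ** B"] by linarith
    have "op_norm (B ** D) \<le> ?R / op_norm (C ** B)"
      by (rule op_norm_leI) (use left pos in \<open>simp add: field_simps\<close>)
    then show ?thesis using pos by (simp add: field_simps)
  qed (use R in simp)
qed

section \<open>A lower bound for long products\<close>

text \<open>If two consecutive factors never cancel by more than \<open>\<delta>\<close>, and the norms of the factors
  dominate \<open>1/\<delta>\<close>, then each new factor multiplies the norm of the product by at least \<open>\<delta>/2\<close> times its own
  norm. In the induction, \<open>op_norm_mult_mult_le\<close> is applied to the new factor, the last one and the
  product of the earlier ones; its error term is at most half of the main term because of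
  \<open>2 \<le> \<delta> * \<mu>\<close>.\<close>

lemma op_norm_product_lower_bound:
  fixes B P :: "nat \<Rightarrow> real^2^2"
  assumes P: "P 0 = mat 1" "\<And>k. P (Suc k) = B k ** P k"
    and det: "\<And>k. det (B k) = 1"
    and mu: "0 < \<mu>" "\<And>k. \<mu> \<le> op_norm (B k)"
    and delta: "0 < \<delta>"
      "\<And>k. \<delta> * op_norm (B (Suc k)) * op_norm (B k) \<le> op_norm (B (Suc k) ** B k)"
    and large: "2 \<le> \<delta> * \<mu>"
  shows "(\<delta> * \<mu> / 2) ^ k \<le> op_norm (P k)"
proof -
  have Bpos: "0 < op_norm (B k)" for k using mu(1) mu(2)[of k] by linarith
  have delta1: "\<delta> \<le> 1"
    using order_trans[OF delta(2)[of 0] op_norm_mult_le] Bpos[of 0] Bpos[of "Suc 0"]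
    by (simp add: mult.assoc mult_le_cancel_right2)
  have step: "\<delta> / 2 * op_norm (B k) * op_norm (P k) \<le> op_norm (P (Suc k))" for k
  proof (induction k)
    case 0
    have "\<delta> / 2 * op_norm (B 0) \<le> 1 * op_norm (B 0)"
      using delta1 Bpos[of 0] by (intro mult_right_mono) auto
    then show ?case using P by (simp add: op_norm_mat_1)
  next
    case (Suc k)
    let ?b = "op_norm (B k)" and ?c = "op_norm (B (Suc k))" and ?p = "op_norm (P k)"
      and ?p1 = "op_norm (P (Suc k))" and ?p2 = "op_norm (P (Suc (Suc k)))"
    have "(\<delta> * ?c * ?b) * ?p1 \<le> op_norm (B (Suc k) ** B k) * op_norm (B k ** P k)"
      using delta(2)[of k] by (simp add: P mult_right_mono op_norm_nonneg)
    also have "\<dots> \<le> ?b * ?p2 + ?c * ?p"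
      using op_norm_mult_mult_le[of "B (Suc k)" "B k" "P k"] det[of k]
      by (simp add: P matrix_mul_assoc)
    finally have 1: "\<delta> * ?c * ?b * ?p1 \<le> ?b * ?p2 + ?c * ?p" .
    have "4 * ?p \<le> (\<delta> * ?b) * (\<delta> * ?b) * ?p"
    proof -
      have "2 \<le> \<delta> * ?b" using large mu(2)[of k] delta(1)
        by (meson mult_left_mono order_trans less_imp_le)
      from mult_mono[OF this this] this show ?thesis
        by (intro mult_right_mono) (auto simp: op_norm_nonneg)
    qed
    also have "\<dots> = 2 * \<delta> * ?b * (\<delta> / 2 * ?b * ?p)" by (simp add: algebra_simps)
    also have "\<dots> \<le> 2 * \<delta> * ?b * ?p1"
      using Suc.IH delta(1) Bpos[of k] by (intro mult_left_mono) auto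
    finally have "?p \<le> \<delta> / 2 * ?b * ?p1" by simp
    then have "?c * ?p \<le> ?c * (\<delta> / 2 * ?b * ?p1)" using Bpos[of "Suc k"] by simp
    with 1 have "?b * (\<delta> / 2 * ?c * ?p1) \<le> ?b * ?p2" by (simp add: algebra_simps)
    then show ?case using Bpos[of k] by (simp add: mult_le_cancel_left_pos)
  qed
  show ?thesis
  proof (induction k)
    case (Suc k)
    have "(\<delta> * \<mu> / 2) ^ Suc k \<le> \<delta> / 2 * op_norm (B k) * op_norm (P k)"
      using Suc delta(1) mu(1) mu(2)[of k] unfolding power_Suc
      by (intro mult_mono) auto
    then show ?case using step[of k] by linarith
  qed (simp add: P op_norm_mat_1)
qed

section \<open>Two scales decide uniformity\<close>

lemma cocycle_iterate_add:
  "cocycle_iterate T A (m + n) \<omega> = cocycle_iterate T A m ((T ^^ n) \<omega>) ** cocycle_iterate T A n \<omega>"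
proof (induction m)
  case (Suc m)
  then show ?case by (simp add: matrix_mul_assoc funpow_add)
qed simp

definition log_norm_iterate :: "('a \<Rightarrow> 'a) \<Rightarrow> ('a \<Rightarrow> real^2^2) \<Rightarrow> nat \<Rightarrow> 'a \<Rightarrow> real"
  where "log_norm_iterate T A n \<omega> = ln (op_norm (cocycle_iterate T A n \<omega>))"

locale sl2_cocycle =
  fixes \<Omega> :: "'a set" and T :: "'a \<Rightarrow> 'a" and A :: "'a \<Rightarrow> real^2^2"
  assumes T_in: "\<omega> \<in> \<Omega> \<Longrightarrow> T \<omega> \<in> \<Omega>"
    and det_A: "\<omega> \<in> \<Omega> \<Longrightarrow> det (A \<omega>) = 1"
begin

abbreviation "g \<equiv> log_norm_iterate T A"

lemma funpow_in: "\<omega> \<in> \<Omega> \<Longrightarrow> (T ^^ n) \<omega> \<in> \<Omega>"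
  by (induction n) (auto intro: T_in)

lemma det_iterate: "\<omega> \<in> \<Omega> \<Longrightarrow> det (cocycle_iterate T A n \<omega>) = 1"
  by (induction n) (auto simp: det_mul det_A funpow_in)

lemma op_norm_iterate: "\<omega> \<in> \<Omega> \<Longrightarrow> op_norm (cocycle_iterate T A n \<omega>) = exp (g n \<omega>)"
  using op_norm_ge_1[OF det_iterate, of \<omega> n] by (simp add: log_norm_iterate_def)

lemma g_nonneg: "\<omega> \<in> \<Omega> \<Longrightarrow> 0 \<le> g n \<omega>"
  using op_norm_ge_1[OF det_iterate, of \<omega> n] by (simp add: log_norm_iterate_def)

lemma g_add_le: "\<omega> \<in> \<Omega> \<Longrightarrow> g (m + n) \<omega> \<le> g m ((T ^^ n) \<omega>) + g n \<omega>"
  using op_norm_mult_le[of "cocycle_iterate T A m ((T ^^ n) \<omega>)" "cocycle_iterate T A n \<omega>"]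
  by (simp add: cocycle_iterate_add[symmetric] op_norm_iterate funpow_in mult_exp_exp)

lemma g_mult_le:
  assumes "\<And>\<omega>. \<omega> \<in> \<Omega> \<Longrightarrow> g n \<omega> \<le> b" "\<omega> \<in> \<Omega>"
  shows "g (k * n) \<omega> \<le> real k * b"
proof (induction k)
  case 0
  then show ?case by (simp add: log_norm_iterate_def op_norm_mat_1)
next
  case (Suc k)
  then show ?case
    using g_add_le[OF assms(2), of n "k * n"] assms(1)[OF funpow_in[OF assms(2)], of "k * n"]
    by (simp add: algebra_simps)
qed

text \<open>The blocks of length \<open>n\<close> satisfy the hypotheses of \<open>op_norm_product_lower_bound\<close> with
  \<open>\<mu> = exp (n (a - \<epsilon>))\<close> and \<open>\<delta> = exp (- 4n\<epsilon>)\<close>: two consecutive blocks have norms at most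
  \<open>exp (n (a + \<epsilon>))\<close> and their product has norm at least \<open>exp (2n (a - \<epsilon>))\<close>. The growth factor
  \<open>\<delta> * \<mu> / 2\<close> per block is at least \<open>exp (n (a - 6\<epsilon>))\<close>, because \<open>n\<epsilon> \<ge> 1\<close> makes up for the \<open>2\<close>.\<close>

lemma g_mult_ge:
  assumes n: "1 \<le> real n * \<epsilon>" and a: "6 * \<epsilon> \<le> a"
    and g: "\<And>\<omega>. \<omega> \<in> \<Omega> \<Longrightarrow> \<bar>g n \<omega> / real n - a\<bar> \<le> \<epsilon>"
      "\<And>\<omega>. \<omega> \<in> \<Omega> \<Longrightarrow> \<bar>g (2 * n) \<omega> / real (2 * n) - a\<bar> \<le> \<epsilon>"
    and \<omega>: "\<omega> \<in> \<Omega>"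
  shows "real (k * n) * (a - 6 * \<epsilon>) \<le> g (k * n) \<omega>"
proof -
  have npos: "0 < real n" using n by (cases "n = 0") auto
  have g1: "real n * (a - \<epsilon>) \<le> g n \<omega>" "g n \<omega> \<le> real n * (a + \<epsilon>)" if "\<omega> \<in> \<Omega>" for \<omega>
    using g(1)[OF that] npos by (auto simp: abs_le_iff field_simps)
  have g2: "2 * real n * (a - \<epsilon>) \<le> g (2 * n) \<omega>" if "\<omega> \<in> \<Omega>" for \<omega>
    using g(2)[OF that] npos by (auto simp: abs_le_iff field_simps)
  define B where "B k = cocycle_iterate T A n ((T ^^ (k * n)) \<omega>)" for k
  define P where "P k = cocycle_iterate T A (k * n) \<omega>" for k
  define \<delta> \<mu> where "\<delta> = exp (- 4 * (real n * \<epsilon>))" and "\<mu> = exp (real n * (a - \<epsilon>))"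
  have in\<Omega>: "(T ^^ (k * n)) \<omega> \<in> \<Omega>" for k using \<omega> by (rule funpow_in)
  have norm_B: "op_norm (B k) = exp (g n ((T ^^ (k * n)) \<omega>))" for k
    unfolding B_def by (rule op_norm_iterate[OF in\<Omega>])
  have "B (Suc k) ** B k = cocycle_iterate T A (2 * n) ((T ^^ (k * n)) \<omega>)" for k
    using cocycle_iterate_add[of T A n n "(T ^^ (k * n)) \<omega>"]
    by (simp add: B_def mult_2 funpow_add)
  then have norm_BB: "op_norm (B (Suc k) ** B k) = exp (g (2 * n) ((T ^^ (k * n)) \<omega>))" for k
    by (simp add: op_norm_iterate[OF in\<Omega>])
  have exp1: "2 \<le> exp (real n * \<epsilon>)"
    using n exp_ge_add_one_self[of "real n * \<epsilon>"] by linarith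
  have rate: "exp (real n * (a - 6 * \<epsilon>)) \<le> \<delta> * \<mu> / 2"
  proof -
    have "exp (real n * (a - 6 * \<epsilon>)) * 2 \<le> exp (real n * (a - 6 * \<epsilon>)) * exp (real n * \<epsilon>)"
      using exp1 by (intro mult_left_mono) auto
    also have "\<dots> = \<delta> * \<mu>" by (simp add: \<delta>_def \<mu>_def exp_add[symmetric] algebra_simps)
    finally show ?thesis by simp
  qed
  have "(\<delta> * \<mu> / 2) ^ k \<le> op_norm (P k)"
  proof (rule op_norm_product_lower_bound[where B = B])
    show "P 0 = mat 1" by (simp add: P_def)
    show "P (Suc k) = B k ** P k" for k
      by (simp add: P_def B_def cocycle_iterate_add)
    show "det (B k) = 1" for k unfolding B_def by (rule det_iterate[OF in\<Omega>])
    show "0 < \<mu>" "0 < \<delta>" by (simp_all add: \<mu>_def \<delta>_def)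
    show "\<mu> \<le> op_norm (B k)" for k
      using g1(1)[OF in\<Omega>] by (simp add: norm_B \<mu>_def)
    show "\<delta> * op_norm (B (Suc k)) * op_norm (B k) \<le> op_norm (B (Suc k) ** B k)" for k
      using g1(2)[OF in\<Omega>[of k]] g1(2)[OF in\<Omega>[of "Suc k"]] g2[OF in\<Omega>[of k]]
      unfolding norm_BB norm_B \<delta>_def exp_add[symmetric] exp_le_cancel_iff
      by (simp add: algebra_simps)
    have "1 \<le> exp (real n * (a - 6 * \<epsilon>))" using a by simp
    with rate show "2 \<le> \<delta> * \<mu>" by linarith
  qed
  moreover have "exp (real (k * n) * (a - 6 * \<epsilon>)) \<le> (\<delta> * \<mu> / 2) ^ k"
    using power_mono[OF rate, of k] by (simp add: exp_of_nat_mult[symmetric] mult_ac)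
  ultimately have "exp (real (k * n) * (a - 6 * \<epsilon>)) \<le> exp (g (k * n) \<omega>)"
    unfolding P_def op_norm_iterate[OF \<omega>] by (rule order_trans[rotated])
  then show ?thesis by simp
qed

lemma g_linear_bound:
  assumes K: "\<And>\<omega>. \<omega> \<in> \<Omega> \<Longrightarrow> op_norm (A \<omega>) \<le> exp K" and \<omega>: "\<omega> \<in> \<Omega>"
  shows "g m \<omega> \<le> real m * K"
proof -
  have "g 1 \<omega> \<le> K" if "\<omega> \<in> \<Omega>" for \<omega>
    using K[OF that] op_norm_iterate[OF that, of 1] by simp
  from g_mult_le[of 1, OF this \<omega>, of m] show ?thesis by simp
qed

text \<open>A general time \<open>m\<close> lies between two multiples of \<open>n\<close>. The upper bound goes from the multiple below
  up to \<open>m\<close>; the lower bound goes from \<open>m\<close> up to the multiple above, so that in both cases the leftover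
  block contributes through subadditivity, and by an amount that is bounded independently of \<open>m\<close>.\<close>

lemma averages_eventually_close:
  assumes K: "0 \<le> K" "\<And>\<omega>. \<omega> \<in> \<Omega> \<Longrightarrow> op_norm (A \<omega>) \<le> exp K"
    and n: "1 \<le> real n * \<epsilon>"
    and g: "\<And>\<omega>. \<omega> \<in> \<Omega> \<Longrightarrow> \<bar>g n \<omega> / real n - a\<bar> \<le> \<epsilon>"
      "\<And>\<omega>. \<omega> \<in> \<Omega> \<Longrightarrow> \<bar>g (2 * n) \<omega> / real (2 * n) - a\<bar> \<le> \<epsilon>"
    and \<epsilon>: "0 < \<epsilon>"
  shows "\<exists>M. \<forall>m\<ge>M. \<forall>\<omega>\<in>\<Omega>. \<bar>g m \<omega> / real m - a\<bar> \<le> 7 * \<epsilon>"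
proof -
  have npos: "0 < n" using n by (cases "n = 0") auto
  obtain M0 :: nat where M0: "real n * K / \<epsilon> \<le> real M0" using real_arch_simple by blast
  show ?thesis
  proof (intro exI allI impI ballI)
    fix m \<omega> assume m: "max 1 M0 \<le> m" and \<omega>: "\<omega> \<in> \<Omega>"
    define q r where "q = m div n" and "r = m mod n"
    have qr: "m = q * n + r" "r < n" using npos by (auto simp: q_def r_def)
    have mpos: "0 < real m" using m by simp
    have mK: "real n * K \<le> real m * \<epsilon>"
      using M0 m \<epsilon> by (simp add: pos_divide_le_eq) (smt (verit) max.bounded_iff mult_right_mono of_nat_le_iff)
    have rem: "g j \<omega>' \<le> real n * K" if "j \<le> n" "\<omega>' \<in> \<Omega>" for j \<omega>'
      using g_linear_bound[OF K(2) that(2), of j] that(1) K(1)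
      by (smt (verit) mult_right_mono of_nat_le_iff)
    have gn: "g n \<omega>' \<le> real n * (a + \<epsilon>)" if "\<omega>' \<in> \<Omega>" for \<omega>'
      using g(1)[OF that] npos by (auto simp: abs_le_iff field_simps)
    have ae: "0 \<le> a + \<epsilon>"
      using gn[OF \<omega>] g_nonneg[OF \<omega>, of n] npos by (smt (verit) mult_pos_neg of_nat_0_less_iff)
    have up: "g m \<omega> \<le> real m * (a + 2 * \<epsilon>)"
    proof -
      have "g m \<omega> \<le> g r ((T ^^ (q * n)) \<omega>) + g (q * n) \<omega>"
        using g_add_le[OF \<omega>, of r "q * n"] qr(1) by (simp add: add.commute)
      also have "\<dots> \<le> real n * K + real q * (real n * (a + \<epsilon>))"
        using qr(2) by (intro add_mono rem g_mult_le gn funpow_in \<omega>) auto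
      also have "\<dots> \<le> real m * \<epsilon> + real m * (a + \<epsilon>)"
      proof (rule add_mono[OF mK])
        have "real (q * n) * (a + \<epsilon>) \<le> real m * (a + \<epsilon>)"
          using ae qr(1) by (intro mult_right_mono) auto
        then show "real q * (real n * (a + \<epsilon>)) \<le> real m * (a + \<epsilon>)" by (simp add: mult_ac)
      qed
      finally show ?thesis by (simp add: algebra_simps)
    qed
    have lo: "real m * (a - 7 * \<epsilon>) \<le> g m \<omega>"
    proof (cases "6 * \<epsilon> \<le> a")
      case True
      have "real m * (a - 6 * \<epsilon>) \<le> real (Suc q * n) * (a - 6 * \<epsilon>)"
        using qr True by (intro mult_right_mono) auto
      also have "\<dots> \<le> g (Suc q * n) \<omega>" by (rule g_mult_ge[OF n True g \<omega>])
      also have "\<dots> \<le> g (n - r) ((T ^^ m) \<omega>) + g m \<omega>"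
        using g_add_le[OF \<omega>, of "n - r" m] qr by (simp add: add.commute)
      also have "\<dots> \<le> real m * \<epsilon> + g m \<omega>"
        using rem[of "n - r" "(T ^^ m) \<omega>"] mK funpow_in[OF \<omega>] by auto
      finally show ?thesis by (simp add: algebra_simps)
    next
      case False
      then have "real m * (a - 7 * \<epsilon>) \<le> 0" using \<epsilon> by (intro mult_nonneg_nonpos) auto
      then show ?thesis using g_nonneg[OF \<omega>, of m] by linarith
    qed
    have "real m * \<epsilon> \<ge> 0" using \<epsilon> by simp
    then show "\<bar>g m \<omega> / real m - a\<bar> \<le> 7 * \<epsilon>"
      using up lo mpos by (simp add: abs_le_iff field_simps)
  qed
qed

end

text \<open>The bound \<open>c < \<epsilon>\<close>, uniform in \<open>\<omega>\<close>, leaves room for small perturbations of \<open>A\<close>. The condition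
  \<open>1 \<le> real n * \<epsilon>\<close> makes blocks of length \<open>n\<close> long enough for factors like \<open>2\<close> to be negligible, and
  excludes \<open>n = 0\<close>. Time \<open>2 * n\<close> is there to detect cancellation between consecutive blocks of length \<open>n\<close>.\<close>

definition nearly_uniform :: "'a set \<Rightarrow> ('a \<Rightarrow> 'a) \<Rightarrow> real \<Rightarrow> ('a \<Rightarrow> real^2^2) \<Rightarrow> bool"
  where "nearly_uniform \<Omega> T \<epsilon> A \<longleftrightarrow> (\<exists>n a c. 1 \<le> real n * \<epsilon> \<and> c < \<epsilon> \<and>
    (\<forall>\<omega>\<in>\<Omega>. \<bar>log_norm_iterate T A n \<omega> / real n - a\<bar> \<le> c \<and>
      \<bar>log_norm_iterate T A (2 * n) \<omega> / real (2 * n) - a\<bar> \<le> c))"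

text \<open>By \<open>averages_eventually_close\<close>, each \<open>\<epsilon>\<close> provides a number that the averages approach up to
  \<open>7\<epsilon>\<close>, uniformly. Hence the averages at one base point form a Cauchy sequence, and its limit is the
  uniform limit.\<close>

lemma uniform_cocycle_iff_nearly_uniform:
  assumes "\<And>\<omega>. \<omega> \<in> \<Omega> \<Longrightarrow> T \<omega> \<in> \<Omega>" "\<And>\<omega>. \<omega> \<in> \<Omega> \<Longrightarrow> det (A \<omega>) = 1" "bounded (A ` \<Omega>)"
  shows "uniform_cocycle \<Omega> T A \<longleftrightarrow> (\<forall>k. nearly_uniform \<Omega> T (1 / real (Suc k)) A)"
proof -
  interpret sl2_cocycle \<Omega> T A by unfold_locales (use assms in auto)
  have conv: "1 / real n * ln (op_norm (cocycle_iterate T A n \<omega>)) = g n \<omega> / real n" for n \<omega>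
    by (simp add: log_norm_iterate_def)
  show ?thesis
  proof
    assume "uniform_cocycle \<Omega> T A"
    then obtain L where L: "uniform_limit \<Omega> (\<lambda>n \<omega>. g n \<omega> / real n) (\<lambda>_. L) sequentially"
      unfolding uniform_cocycle_def conv by blast
    show "\<forall>k. nearly_uniform \<Omega> T (1 / real (Suc k)) A"
    proof
      fix k
      define \<epsilon> where "\<epsilon> = 1 / real (Suc k)"
      have \<epsilon>: "0 < \<epsilon>" by (simp add: \<epsilon>_def)
      obtain M where M: "\<And>m \<omega>. m \<ge> M \<Longrightarrow> \<omega> \<in> \<Omega> \<Longrightarrow> \<bar>g m \<omega> / real m - L\<bar> < \<epsilon> / 2"
        using L \<epsilon> unfolding uniform_limit_sequentially_iff dist_real_def by (meson half_gt_zero)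
      define n where "n = max M (Suc k)"
      have "1 \<le> real n * \<epsilon>" by (simp add: n_def \<epsilon>_def)
      moreover have "\<forall>\<omega>\<in>\<Omega>. \<bar>g n \<omega> / real n - L\<bar> \<le> \<epsilon> / 2
          \<and> \<bar>g (2 * n) \<omega> / real (2 * n) - L\<bar> \<le> \<epsilon> / 2"
        by (intro ballI conjI less_imp_le[OF M]) (auto simp: n_def max_def)
      ultimately show "nearly_uniform \<Omega> T (1 / real (Suc k)) A"
        unfolding nearly_uniform_def \<epsilon>_def[symmetric]
        using \<epsilon> by (intro exI[of _ n] exI[of _ L] exI[of _ "\<epsilon> / 2"]) auto
    qed
  next
    assume near: "\<forall>k. nearly_uniform \<Omega> T (1 / real (Suc k)) A"
    obtain b where b: "0 < b" "\<And>\<omega>. \<omega> \<in> \<Omega> \<Longrightarrow> norm (A \<omega>) \<le> b"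
      using assms(3) by (auto simp: bounded_pos)
    have K: "op_norm (A \<omega>) \<le> exp b" if "\<omega> \<in> \<Omega>" for \<omega>
      using op_norm_le_norm[of "A \<omega>"] b(2)[OF that] exp_ge_add_one_self[of b] by linarith
    have close: "\<exists>a M. \<forall>m\<ge>M. \<forall>\<omega>\<in>\<Omega>. \<bar>g m \<omega> / real m - a\<bar> < e" if e: "0 < e" for e :: real
    proof -
      obtain k where k: "1 / real (Suc k) < e / 7"
        using e by (metis nat_approx_posE zero_less_divide_iff zero_less_numeral)
      let ?\<epsilon> = "1 / real (Suc k)"
      obtain n a c where n: "1 \<le> real n * ?\<epsilon>" and c: "c < ?\<epsilon>"
        and g: "\<And>\<omega>. \<omega> \<in> \<Omega> \<Longrightarrow> \<bar>g n \<omega> / real n - a\<bar> \<le> c"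
          "\<And>\<omega>. \<omega> \<in> \<Omega> \<Longrightarrow> \<bar>g (2 * n) \<omega> / real (2 * n) - a\<bar> \<le> c"
        using near unfolding nearly_uniform_def by blast
      have "\<exists>M. \<forall>m\<ge>M. \<forall>\<omega>\<in>\<Omega>. \<bar>g m \<omega> / real m - a\<bar> \<le> 7 * ?\<epsilon>"
        using b(1) c
        by (intro averages_eventually_close[OF _ K n] order_trans[OF g(1) less_imp_le]
            order_trans[OF g(2) less_imp_le]) auto
      then show ?thesis using k by (metis less_divide_eq_numeral1(1) mult.commute order_le_less_trans)
    qed
    show "uniform_cocycle \<Omega> T A"
    proof (cases "\<Omega> = {}")
      case False
      then obtain z where z: "z \<in> \<Omega>" by blast
      define x where "x m = g m z / real m" for m
      have "Cauchy x"
      proof (rule metric_CauchyI)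
        fix e :: real assume "0 < e"
        then obtain a M where "\<forall>m\<ge>M. \<forall>\<omega>\<in>\<Omega>. \<bar>g m \<omega> / real m - a\<bar> < e / 2"
          using close[of "e / 2"] by auto
        then have "\<forall>m\<ge>M. dist (x m) a < e / 2" using z by (simp add: x_def dist_real_def)
        then show "\<exists>M. \<forall>m\<ge>M. \<forall>n\<ge>M. dist (x m) (x n) < e" by (metis dist_triangle_half_l)
      qed
      then obtain L where L: "x \<longlonglongrightarrow> L" using Cauchy_convergent convergent_def by blast
      have "\<exists>N. \<forall>\<omega>\<in>\<Omega>. \<forall>m\<ge>N. dist (g m \<omega> / real m) L < e" if e: "0 < e" for e :: real
      proof -
        obtain a M where M: "\<And>m \<omega>. m \<ge> M \<Longrightarrow> \<omega> \<in> \<Omega> \<Longrightarrow> \<bar>g m \<omega> / real m - a\<bar> < e / 3"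
          using close[of "e / 3"] e by auto
        obtain M' where M': "\<And>m. m \<ge> M' \<Longrightarrow> \<bar>x m - L\<bar> < e / 3"
          using LIMSEQ_D[OF L, of "e / 3"] e by auto
        have "dist (g m \<omega> / real m) L < e" if "\<omega> \<in> \<Omega>" "max M M' \<le> m" for \<omega> m
        proof -
          have "\<bar>g m \<omega> / real m - a\<bar> < e / 3" "\<bar>g m z / real m - a\<bar> < e / 3" "\<bar>x m - L\<bar> < e / 3"
            using M[of m] M'[of m] that z by auto
          then show ?thesis unfolding x_def dist_real_def by linarith
        qed
        then show ?thesis by blast
      qed
      then show ?thesis
        unfolding uniform_cocycle_def conv uniform_limit_sequentially_iff by blast
    qed (simp add: uniform_cocycle_def)
  qed
qed

section \<open>Openness of the two-scale condition\<close>

lemma bounded_bilinear_matrix_matrix_mult: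
  "bounded_bilinear ((**) :: real^'n^'m \<Rightarrow> real^'k^'n \<Rightarrow> real^'k^'m)"
  unfolding bilinear_conv_bounded_bilinear[symmetric] bilinear_def
  by (auto intro!: linearI simp: matrix_matrix_mult_def vec_eq_iff sum_distrib_left sum.distrib algebra_simps)

lemma bounded_cocycle_iterate:
  assumes T: "\<And>\<omega>. \<omega> \<in> \<Omega> \<Longrightarrow> T \<omega> \<in> \<Omega>" and bdd: "bounded (A ` \<Omega>)"
  shows "bounded (cocycle_iterate T A n ` \<Omega>)"
proof (induction n)
  case 0
  then show ?case by (rule finite_imp_bounded) (auto intro: finite_subset[of _ "{mat 1}"])
next
  case (Suc n)
  have Tn: "(T ^^ n) \<omega> \<in> \<Omega>" if "\<omega> \<in> \<Omega>" for \<omega>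
    using that by (induction n) (auto intro: T)
  obtain C where C: "\<And>(M :: real^2^2) (N :: real^2^2). norm (M ** N) \<le> norm M * norm N * C" "0 \<le> C"
    using bounded_bilinear.nonneg_bounded[OF bounded_bilinear_matrix_matrix_mult] by blast
  obtain a b where a: "\<And>\<omega>. \<omega> \<in> \<Omega> \<Longrightarrow> norm (A \<omega>) \<le> a"
    and b: "\<And>\<omega>. \<omega> \<in> \<Omega> \<Longrightarrow> norm (cocycle_iterate T A n \<omega>) \<le> b"
    using bdd Suc.IH by (auto simp: bounded_iff)
  have "norm (cocycle_iterate T A (Suc n) \<omega>) \<le> a * b * C" if "\<omega> \<in> \<Omega>" for \<omega>
  proof -
    have "norm (cocycle_iterate T A (Suc n) \<omega>)
        \<le> norm (A ((T ^^ n) \<omega>)) * norm (cocycle_iterate T A n \<omega>) * C"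
      unfolding cocycle_iterate.simps by (rule C(1))
    also have "\<dots> \<le> a * b * C"
      using a[OF Tn[OF that]] b[OF that] C(2)
      by (intro mult_right_mono mult_mono) (auto intro: order_trans[OF norm_ge_zero])
    finally show ?thesis .
  qed
  then show ?case unfolding bounded_iff by blast
qed

lemma uniform_limit_cocycle_iterate:
  assumes T: "\<And>\<omega>. \<omega> \<in> \<Omega> \<Longrightarrow> T \<omega> \<in> \<Omega>" and bdd: "bounded (A ` \<Omega>)"
    and lim: "uniform_limit \<Omega> f A F"
  shows "uniform_limit \<Omega> (\<lambda>i. cocycle_iterate T (f i) n) (cocycle_iterate T A n) F"
proof (induction n)
  case 0
  then show ?case by (simp add: uniform_limit_const)
next
  case (Suc n)
  have Tn: "(T ^^ n) ` \<Omega> \<subseteq> \<Omega>"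
    by (induction n) (auto intro: T)
  have "uniform_limit \<Omega> (\<lambda>i \<omega>. f i ((T ^^ n) \<omega>)) (\<lambda>\<omega>. A ((T ^^ n) \<omega>)) F"
    using uniform_limit_compose'[OF lim, of "T ^^ n" \<Omega>] Tn by auto
  moreover have "bounded ((\<lambda>\<omega>. A ((T ^^ n) \<omega>)) ` \<Omega>)"
    using bdd by (rule bounded_subset) (use Tn in auto)
  ultimately show ?case
    unfolding cocycle_iterate.simps
    by (intro bounded_bilinear.bounded_uniform_limit[OF bounded_bilinear_matrix_matrix_mult]
        Suc.IH bounded_cocycle_iterate T bdd)
qed

lemma abs_ln_diff_le:
  fixes x y :: real
  assumes "1 \<le> x" "1 \<le> y"
  shows "\<bar>ln x - ln y\<bar> \<le> \<bar>x - y\<bar>"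
proof -
  have "ln u - ln v \<le> \<bar>u - v\<bar>" if "1 \<le> u" "1 \<le> v" for u v :: real
  proof -
    have "ln u - ln v \<le> (u - v) / v" using that by (intro ln_diff_le) auto
    also have "\<dots> \<le> \<bar>u - v\<bar> / 1" using that by (intro frac_le) auto
    finally show ?thesis by simp
  qed
  from this[OF assms] this[OF assms(2,1)] show ?thesis by linarith
qed

text \<open>The logarithm is Lipschitz on \<open>[1, \<infinity>)\<close>, where the norms of matrices of determinant one lie, so
  uniform convergence of the iterates carries over.\<close>

lemma uniform_limit_log_norm_iterate:
  assumes T: "\<And>\<omega>. \<omega> \<in> \<Omega> \<Longrightarrow> T \<omega> \<in> \<Omega>" and bdd: "bounded (A ` \<Omega>)"
    and lim: "uniform_limit \<Omega> f A F"
    and det: "\<And>\<omega>. \<omega> \<in> \<Omega> \<Longrightarrow> det (A \<omega>) = 1" "\<And>i \<omega>. \<omega> \<in> \<Omega> \<Longrightarrow> det (f i \<omega>) = 1"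
  shows "uniform_limit \<Omega> (\<lambda>i. log_norm_iterate T (f i) n) (log_norm_iterate T A n) F"
proof (rule metric_uniform_limit_imp_uniform_limit[OF uniform_limit_cocycle_iterate[OF T bdd lim]])
  interpret A: sl2_cocycle \<Omega> T A by unfold_locales (use T det in auto)
  have f: "sl2_cocycle \<Omega> T (f i)" for i by unfold_locales (use T det in auto)
  show "\<forall>\<^sub>F i in F. \<forall>\<omega>\<in>\<Omega>. dist (log_norm_iterate T (f i) n \<omega>) (log_norm_iterate T A n \<omega>)
      \<le> dist (cocycle_iterate T (f i) n \<omega>) (cocycle_iterate T A n \<omega>)"
  proof (intro always_eventually allI ballI)
    fix i \<omega> assume \<omega>: "\<omega> \<in> \<Omega>"
    have "\<bar>ln (op_norm (cocycle_iterate T (f i) n \<omega>)) - ln (op_norm (cocycle_iterate T A n \<omega>))\<bar>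
        \<le> norm (cocycle_iterate T (f i) n \<omega> - cocycle_iterate T A n \<omega>)"
      by (intro order_trans[OF abs_ln_diff_le abs_op_norm_diff_le] op_norm_ge_1
          A.det_iterate sl2_cocycle.det_iterate[OF f] \<omega>)
    then show "dist (log_norm_iterate T (f i) n \<omega>) (log_norm_iterate T A n \<omega>)
        \<le> dist (cocycle_iterate T (f i) n \<omega>) (cocycle_iterate T A n \<omega>)"
      by (simp add: log_norm_iterate_def dist_norm)
  qed
qed

lemma eventually_nearly_uniform:
  assumes T: "\<And>\<omega>. \<omega> \<in> \<Omega> \<Longrightarrow> T \<omega> \<in> \<Omega>" and bdd: "bounded (A ` \<Omega>)"
    and lim: "uniform_limit \<Omega> f A F"
    and det: "\<And>\<omega>. \<omega> \<in> \<Omega> \<Longrightarrow> det (A \<omega>) = 1" "\<And>i \<omega>. \<omega> \<in> \<Omega> \<Longrightarrow> det (f i \<omega>) = 1"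
    and near: "nearly_uniform \<Omega> T \<epsilon> A"
  shows "\<forall>\<^sub>F i in F. nearly_uniform \<Omega> T \<epsilon> (f i)"
proof -
  obtain n a c where n: "1 \<le> real n * \<epsilon>" and c: "c < \<epsilon>"
    and g: "\<And>\<omega>. \<omega> \<in> \<Omega> \<Longrightarrow> \<bar>log_norm_iterate T A n \<omega> / real n - a\<bar> \<le> c"
      "\<And>\<omega>. \<omega> \<in> \<Omega> \<Longrightarrow> \<bar>log_norm_iterate T A (2 * n) \<omega> / real (2 * n) - a\<bar> \<le> c"
    using near unfolding nearly_uniform_def by blast
  define \<eta> where "\<eta> = (\<epsilon> - c) / 2"
  have \<eta>: "0 < \<eta>" using c by (simp add: \<eta>_def)
  have npos: "1 \<le> n" using n by (cases n) auto
  have "\<forall>\<^sub>F i in F. \<forall>\<omega>\<in>\<Omega>. dist (log_norm_iterate T (f i) m \<omega>) (log_norm_iterate T A m \<omega>) < \<eta>" for m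
    by (rule uniform_limitD[OF uniform_limit_log_norm_iterate[OF T bdd lim det] \<eta>])
  from this[of n] this[of "2 * n"] show ?thesis
  proof eventually_elim
    case (elim i)
    have avg: "\<bar>u / real m - a\<bar> \<le> c + \<eta>"
      if "\<bar>v / real m - a\<bar> \<le> c" "dist u v < \<eta>" "1 \<le> m" for u v and m :: nat
    proof -
      have "\<bar>u / real m - v / real m\<bar> = \<bar>u - v\<bar> / real m"
        by (simp add: diff_divide_distrib[symmetric])
      also have "\<dots> \<le> \<bar>u - v\<bar> / 1" using that(3) by (intro frac_le) auto
      finally show ?thesis using that(1,2) by (simp add: dist_real_def)
    qed
    have "\<forall>\<omega>\<in>\<Omega>. \<bar>log_norm_iterate T (f i) n \<omega> / real n - a\<bar> \<le> c + \<eta>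
        \<and> \<bar>log_norm_iterate T (f i) (2 * n) \<omega> / real (2 * n) - a\<bar> \<le> c + \<eta>"
      using elim npos by (intro ballI conjI avg[OF g(1)] avg[OF g(2)]) auto
    moreover have "c + \<eta> < \<epsilon>" using c by (simp add: \<eta>_def field_simps)
    ultimately show ?case using n unfolding nearly_uniform_def by blast
  qed
qed

text \<open>A property of maps on \<open>\<Omega>\<close> that is open for uniform convergence gives, when it is asked for a compact
  set of parameters, an open property of maps on \<open>I \<times> \<Omega>\<close>. If it is not open at \<open>A\<close>, there are maps \<open>B k\<close> tending to \<open>A\<close>
  uniformly on \<open>K \<times> \<Omega>\<close> and parameters \<open>E k\<close> in \<open>K\<close> at which the property fails. Along a subsequence
  the parameters converge to some \<open>E0\<close>, and by uniform continuity of \<open>A\<close> on \<open>K \<times> \<Omega>\<close> the bad slices converge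
  uniformly to the slice of \<open>A\<close> at \<open>E0\<close>, which has the property.\<close>

lemma openin_loc_unif_all_slices:
  fixes \<Omega> :: "'a::metric_space set" and I :: "'e::metric_space set" and Y :: "'b::metric_space set"
  assumes K: "compact K" "K \<subseteq> I" and \<Omega>: "compact \<Omega>"
    and stable: "\<And>f g. (\<And>k. continuous_on \<Omega> (f k) \<and> f k ` \<Omega> \<subseteq> Y) \<Longrightarrow> continuous_on \<Omega> g \<Longrightarrow>
      g ` \<Omega> \<subseteq> Y \<Longrightarrow> uniform_limit \<Omega> f g sequentially \<Longrightarrow> P g \<Longrightarrow> \<exists>k::nat. P (f k)"
  shows "openin (loc_unif_topology (I \<times> \<Omega>) Y)
    {A \<in> cont_maps (I \<times> \<Omega>) Y. \<forall>E\<in>K. P (\<lambda>\<omega>. A (E, \<omega>))}" (is "openin _ ?W")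
  unfolding openin_loc_unif_topology
proof (intro conjI ballI)
  fix A assume A: "A \<in> ?W"
  have cpt: "compact (K \<times> \<Omega>)" using K \<Omega> by (intro compact_Times)
  have slice: "continuous_on \<Omega> (\<lambda>\<omega>. B (E, \<omega>)) \<and> (\<lambda>\<omega>. B (E, \<omega>)) ` \<Omega> \<subseteq> Y"
    if "B \<in> cont_maps (I \<times> \<Omega>) Y" "E \<in> K" for B E
  proof
    have cB: "continuous_on (I \<times> \<Omega>) B" and B: "B \<in> I \<times> \<Omega> \<rightarrow> Y"
      using that(1) by (auto simp: cont_maps_def PiE_iff)
    show "continuous_on \<Omega> (\<lambda>\<omega>. B (E, \<omega>))"
      by (rule continuous_on_compose2[OF cB]) (use that K in \<open>auto intro!: continuous_intros\<close>)
    show "(\<lambda>\<omega>. B (E, \<omega>)) ` \<Omega> \<subseteq> Y" using B that K by auto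
  qed
  have "\<exists>e>0. {g \<in> cont_maps (I \<times> \<Omega>) Y. \<forall>x\<in>K \<times> \<Omega>. dist (g x) (A x) < e} \<subseteq> ?W"
  proof (rule ccontr)
    assume "\<not> ?thesis"
    then have "\<exists>B E. B \<in> cont_maps (I \<times> \<Omega>) Y \<and> (\<forall>x\<in>K \<times> \<Omega>. dist (B x) (A x) < 1 / real (Suc k))
        \<and> E \<in> K \<and> \<not> P (\<lambda>\<omega>. B (E, \<omega>))" for k
      by (force dest: spec[of _ "1 / real (Suc k)"])
    then obtain B E where B: "\<And>k. B k \<in> cont_maps (I \<times> \<Omega>) Y"
      and BA: "\<And>k x. x \<in> K \<times> \<Omega> \<Longrightarrow> dist (B k x) (A x) < 1 / real (Suc k)"
      and E: "\<And>k. E k \<in> K" and notP: "\<And>k. \<not> P (\<lambda>\<omega>. B k (E k, \<omega>))"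
      by metis
    obtain E0 r where E0: "E0 \<in> K" and r: "strict_mono r" and lim: "(E \<circ> r) \<longlonglongrightarrow> E0"
      using K(1) E unfolding compact_def by metis
    have unif: "uniformly_continuous_on (K \<times> \<Omega>) A"
      using A K by (intro compact_uniformly_continuous cpt)
        (auto simp: cont_maps_def intro: continuous_on_subset)
    have "uniform_limit \<Omega> (\<lambda>k \<omega>. B (r k) (E (r k), \<omega>)) (\<lambda>\<omega>. A (E0, \<omega>)) sequentially"
    proof (rule uniform_limitI)
      fix e :: real assume "0 < e"
      then have e: "0 < e / 2" by simp
      then obtain d where d: "0 < d"
        "\<And>x x'. x \<in> K \<times> \<Omega> \<Longrightarrow> x' \<in> K \<times> \<Omega> \<Longrightarrow> dist x' x < d \<Longrightarrow> dist (A x') (A x) < e / 2"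
        using unif unfolding uniformly_continuous_on_def by metis
      have "\<forall>\<^sub>F k in sequentially. 1 / real (Suc k) < e / 2"
        by (rule order_tendstoD(2)[OF lim_1_over_n[THEN LIMSEQ_Suc] e])
      moreover have "\<forall>\<^sub>F k in sequentially. dist (E (r k)) E0 < d"
        using tendstoD[OF lim d(1)] by simp
      ultimately show "\<forall>\<^sub>F k in sequentially.
          \<forall>\<omega>\<in>\<Omega>. dist (B (r k) (E (r k), \<omega>)) (A (E0, \<omega>)) < e"
      proof eventually_elim
        case (elim k)
        show ?case
        proof
          fix \<omega> assume \<omega>: "\<omega> \<in> \<Omega>"
          have "1 / real (Suc (r k)) \<le> 1 / real (Suc k)"
            using seq_suble[OF r, of k] by (intro divide_left_mono) auto
          then have "dist (B (r k) (E (r k), \<omega>)) (A (E (r k), \<omega>)) < e / 2"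
            using BA[of "(E (r k), \<omega>)" "r k"] E \<omega> elim(1) by fastforce
          moreover have "dist (A (E (r k), \<omega>)) (A (E0, \<omega>)) < e / 2"
            using d(2)[of "(E0, \<omega>)" "(E (r k), \<omega>)"] E E0 \<omega> elim(2) by (auto simp: dist_Pair_Pair)
          ultimately show "dist (B (r k) (E (r k), \<omega>)) (A (E0, \<omega>)) < e"
            using dist_triangle[of "B (r k) (E (r k), \<omega>)" "A (E0, \<omega>)" "A (E (r k), \<omega>)"] by linarith
        qed
      qed
    qed
    then have "\<exists>k. P (\<lambda>\<omega>. B (r k) (E (r k), \<omega>))"
      using A E0 slice[OF B E] slice[of A E0]
      by (intro stable[where g = "\<lambda>\<omega>. A (E0, \<omega>)"]) auto
    then show False using notP by blast
  qed
  then show "\<exists>L e. compact L \<and> L \<subseteq> I \<times> \<Omega> \<and> 0 < e \<and>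
      {g \<in> cont_maps (I \<times> \<Omega>) Y. \<forall>x\<in>L. dist (g x) (A x) < e} \<subseteq> ?W"
    using cpt K(2) by (intro exI[of _ "K \<times> \<Omega>"]) auto
qed auto

section \<open>Countably many conditions\<close>

text \<open>Take as end points the rational points of \<open>I\<close> together with its least and its greatest element,
  as far as these exist.\<close>

lemma interval_countably_covered_by_compact_subintervals:
  fixes I :: "real set"
  assumes "is_interval I"
  obtains D where "countable D" "\<And>a b. a \<in> D \<Longrightarrow> b \<in> D \<Longrightarrow> {a..b} \<subseteq> I"
    "\<And>x. x \<in> I \<Longrightarrow> \<exists>a\<in>D. \<exists>b\<in>D. x \<in> {a..b}"
proof
  define D where "D = I \<inter> (\<rat> \<union> {x. \<forall>y\<in>I. x \<le> y} \<union> {x. \<forall>y\<in>I. y \<le> x})"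
  have "countable (I \<inter> {x. \<forall>y\<in>I. x \<le> y})"
    by (rule countable_subset[of _ "{Inf I}"]) (auto simp: cInf_eq_minimum)
  moreover have "countable (I \<inter> {x. \<forall>y\<in>I. y \<le> x})"
    by (rule countable_subset[of _ "{Sup I}"]) (auto simp: cSup_eq_maximum)
  moreover have "countable (I \<inter> \<rat>)" by (simp add: countable_rat)
  ultimately show "countable D" unfolding D_def Int_Un_distrib by blast
  have between: "z \<in> I" if "a \<in> I" "b \<in> I" "a \<le> z" "z \<le> b" for a b z
    using assms that unfolding is_interval_1 by blast
  show "{a..b} \<subseteq> I" if "a \<in> D" "b \<in> D" for a b
    using between[of a b] that by (auto simp: D_def)
  show "\<exists>a\<in>D. \<exists>b\<in>D. x \<in> {a..b}" if x: "x \<in> I" for x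
  proof -
    have "\<exists>a\<in>D. a \<le> x"
    proof (cases "\<forall>y\<in>I. x \<le> y")
      case False
      then obtain y where y: "y \<in> I" "y < x" by force
      obtain q where "q \<in> \<rat>" "y < q" "q < x" using Rats_dense_in_real[OF y(2)] by blast
      then show ?thesis using between[of y x q] x y by (intro bexI[of _ q]) (auto simp: D_def)
    qed (use x in \<open>auto simp: D_def\<close>)
    moreover have "\<exists>b\<in>D. x \<le> b"
    proof (cases "\<forall>y\<in>I. y \<le> x")
      case False
      then obtain y where y: "y \<in> I" "x < y" by force
      obtain q where "q \<in> \<rat>" "x < q" "q < y" using Rats_dense_in_real[OF y(2)] by blast
      then show ?thesis using between[of x y q] x y by (intro bexI[of _ q]) (auto simp: D_def)
    qed (use x in \<open>auto simp: D_def\<close>)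
    ultimately show ?thesis by auto
  qed
qed

theorem theorem1p4:
  fixes \<Omega> :: "'a::metric_space set" and T :: "'a \<Rightarrow> 'a" and I :: "real set"
  assumes "dynamical_system \<Omega> T"
    and "is_interval I"
  shows "gdelta_in (loc_unif_topology (I \<times> \<Omega>) SL2R) (U_set I \<Omega> T)"
proof -
  have \<Omega>: "compact \<Omega>" and T: "\<And>\<omega>. \<omega> \<in> \<Omega> \<Longrightarrow> T \<omega> \<in> \<Omega>"
    using assms(1) by (auto simp: dynamical_system_def homeomorphism_def)
  let ?X = "loc_unif_topology (I \<times> \<Omega>) SL2R"
  obtain D where D: "countable D" "\<And>a b. a \<in> D \<Longrightarrow> b \<in> D \<Longrightarrow> {a..b} \<subseteq> I"
    "\<And>E. E \<in> I \<Longrightarrow> \<exists>a\<in>D. \<exists>b\<in>D. E \<in> {a..b}"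
    using interval_countably_covered_by_compact_subintervals[OF assms(2)] by metis
  define W where "W = (\<lambda>((a, b), k). {A \<in> cont_maps (I \<times> \<Omega>) SL2R.
    \<forall>E\<in>{a..b}. nearly_uniform \<Omega> T (1 / real (Suc k)) (\<lambda>\<omega>. A (E, \<omega>))})"
  have W: "openin ?X (W ((a, b), k))" if "a \<in> D" "b \<in> D" for a b k
    unfolding W_def prod.case
  proof (rule openin_loc_unif_all_slices)
    show "{a..b} \<subseteq> I" using that by (rule D(2))
    fix f g assume f: "\<And>i. continuous_on \<Omega> (f i) \<and> f i ` \<Omega> \<subseteq> SL2R"
      and g: "continuous_on \<Omega> g" "g ` \<Omega> \<subseteq> SL2R"
      and lim: "uniform_limit \<Omega> f g sequentially" and P: "nearly_uniform \<Omega> T (1 / real (Suc k)) g"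
    have "\<forall>\<^sub>F i in sequentially. nearly_uniform \<Omega> T (1 / real (Suc k)) (f i)"
      using f g by (intro eventually_nearly_uniform[OF T _ lim _ _ P])
        (auto simp: SL2R_def image_subset_iff intro: compact_imp_bounded compact_continuous_image \<Omega>)
    then show "\<exists>i. nearly_uniform \<Omega> T (1 / real (Suc k)) (f i)"
      using eventually_happens trivial_limit_sequentially by blast
  qed (use \<Omega> in auto)
  have uniform: "uniform_cocycle \<Omega> T (\<lambda>\<omega>. A (E, \<omega>)) \<longleftrightarrow>
      (\<forall>k. nearly_uniform \<Omega> T (1 / real (Suc k)) (\<lambda>\<omega>. A (E, \<omega>)))"
    if A: "A \<in> cont_maps (I \<times> \<Omega>) SL2R" and E: "E \<in> I" for A E
  proof (rule uniform_cocycle_iff_nearly_uniform)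
    show "det (A (E, \<omega>)) = 1" if "\<omega> \<in> \<Omega>" for \<omega>
      using A E that by (auto simp: cont_maps_def SL2R_def)
    have "continuous_on \<Omega> (\<lambda>\<omega>. A (E, \<omega>))"
      by (rule continuous_on_compose2[of "I \<times> \<Omega>" A])
        (use A E in \<open>auto simp: cont_maps_def intro!: continuous_intros\<close>)
    then show "bounded ((\<lambda>\<omega>. A (E, \<omega>)) ` \<Omega>)"
      by (intro compact_imp_bounded compact_continuous_image \<Omega>)
  qed (rule T)
  \<comment> \<open>The whole space is one of the sets because \<open>D\<close> is empty when \<open>I\<close> is.\<close>
  have "U_set I \<Omega> T = \<Inter> (insert (topspace ?X) (W ` ((D \<times> D) \<times> UNIV)))"
    unfolding topspace_loc_unif_topology
  proof (intro equalityI subsetI)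
    fix A assume "A \<in> U_set I \<Omega> T"
    then have A: "A \<in> cont_maps (I \<times> \<Omega>) SL2R"
        "\<And>E k. E \<in> I \<Longrightarrow> nearly_uniform \<Omega> T (1 / real (Suc k)) (\<lambda>\<omega>. A (E, \<omega>))"
      using uniform[of A] unfolding U_set_def by blast+
    have "A \<in> W ((a, b), k)" if "a \<in> D" "b \<in> D" for a b k
      using A D(2)[OF that] unfolding W_def prod.case by blast
    with A(1) show "A \<in> \<Inter> (insert (cont_maps (I \<times> \<Omega>) SL2R) (W ` ((D \<times> D) \<times> UNIV)))"
      by blast
  next
    fix A assume A: "A \<in> \<Inter> (insert (cont_maps (I \<times> \<Omega>) SL2R) (W ` ((D \<times> D) \<times> UNIV)))"
    have "nearly_uniform \<Omega> T (1 / real (Suc k)) (\<lambda>\<omega>. A (E, \<omega>))" if E: "E \<in> I" for E k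
    proof -
      obtain a b where ab: "a \<in> D" "b \<in> D" "E \<in> {a..b}" using D(3)[OF E] by blast
      have "W ((a, b), k) \<in> W ` ((D \<times> D) \<times> UNIV)" using ab by (intro imageI) simp
      then have "A \<in> W ((a, b), k)" using A by (meson InterD insertI2)
      then show ?thesis using ab(3) by (simp add: W_def)
    qed
    then show "A \<in> U_set I \<Omega> T" using A uniform[of A] by (simp add: U_set_def)
  qed
  moreover have "gdelta_in ?X (\<Inter> (insert (topspace ?X) (W ` ((D \<times> D) \<times> UNIV))))"
    using D(1) by (intro gdelta_in_Inter) (auto intro!: open_imp_gdelta_in W)
  ultimately show ?thesis by simp
qed

end
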